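(* Let $\Omega\subseteq\mathbb{C}$ be a connected open set. Every operator $T$ in $\mathcal{F}B_2(\Omega)$ is irreducible. Moreover, if $T_0\in B_1(\Omega)$ and $T=\begin{pmatrix}T_0&I\\0&T_0\end{pmatrix}$, then $T$ is strongly irreducible.
   Context: All Hilbert spaces are complex and separable and all operators are bounded and linear. For a connected open set $\Omega\subseteq\mathbb{C}$, $B_1(\Omega)$ (the Cowen-Douglas class of rank one) is the set of bounded operators $T$ on a Hilbert space $\mathcal{H}$ such that $\Omega\subset\sigma(T)$; $\mathrm{ran}(T-w)=\mathcal{H}$ for all $w\in\Omega$; the closed linear span of $\bigcup_{w\in\Omega}\ker(T-w)$ is $\mathcal{H}$; and $\dim\ker(T-w)=1$ for all $w\in\Omega$. $\mathcal{F}B_2(\Omega)$ is the set of bounded operators $T=\begin{pmatrix}T_0&S\\0&T_1\end{pmatrix}$ on an orthogonal direct sum $\mathcal{H}_0\oplus\mathcal{H}_1$, where $T_0:\mathcal{H}_0\to\mathcal{H}_0$ and $T_1:\mathcal{H}_1\to\mathcal{H}_1$ are in $B_1(\Omega)$ and $S:\mathcal{H}_1\to\mathcal{H}_0$ is a non-zero bounded operator with $T_0S=ST_1$. An operator $T$ is irreducible if the only orthogonal projections commuting with $T$ are $0$ and $I$. It is strongly irreducible if the only (not necessarily self-adjoint) bounded idempotents commuting with $T$ are $0$ and $I$. *)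

theory Defs
  imports "HOL-Analysis.Analysis"
begin

section \<open>Complex separable Hilbert spaces\<close>

class complex_vector = real_vector +
  fixes scaleC :: "complex \<Rightarrow> 'a \<Rightarrow> 'a"  (infixr "*\<^sub>C" 75)
  assumes scaleC_add_right: "c *\<^sub>C (x + y) = c *\<^sub>C x + c *\<^sub>C y"
    and scaleC_add_left: "(c + d) *\<^sub>C x = c *\<^sub>C x + d *\<^sub>C x"
    and scaleC_scaleC: "c *\<^sub>C (d *\<^sub>C x) = (c * d) *\<^sub>C x"
    and scaleC_one: "1 *\<^sub>C x = x"
    and scaleR_eq_scaleC: "r *\<^sub>R x = complex_of_real r *\<^sub>C x"

global_interpretation complex_vector: vector_space "scaleC :: complex \<Rightarrow> 'a \<Rightarrow> 'a::complex_vector"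
  defines cspan = complex_vector.span
    and cdim = complex_vector.dim
  by unfold_locales
    (simp_all add: scaleC_add_right scaleC_add_left scaleC_scaleC scaleC_one)

text \<open>
  The scalar product is linear in its first argument. Its real part is the real inner product
  of the library, so norm, distance and topology are those of \<^class>\<open>real_inner\<close>; positive
  definiteness is inherited from there.
\<close>

class complex_inner = complex_vector + real_inner +
  fixes cinner :: "'a \<Rightarrow> 'a \<Rightarrow> complex"
  assumes cinner_commute: "cinner x y = cnj (cinner y x)"
    and cinner_add_left: "cinner (x + y) z = cinner x z + cinner y z"
    and cinner_scaleC_left: "cinner (c *\<^sub>C x) y = c * cinner x y"
    and inner_eq_Re_cinner: "inner x y = Re (cinner x y)"

class chilbert = complex_inner + complete_space +
  assumes ex_countable_dense: "\<exists>D. countable D \<and> (\<forall>U. open U \<and> U \<noteq> {} \<longrightarrow> D \<inter> U \<noteq> {})"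

lemma chilbert_separable: "separable_space (euclidean :: 'a::chilbert topology)"
proof -
  obtain D :: "'a set" where D: "countable D" "\<And>U. open U \<Longrightarrow> U \<noteq> {} \<Longrightarrow> D \<inter> U \<noteq> {}"
    using ex_countable_dense by blast
  have "x \<in> closure D" for x
    using D(2) by (auto simp: closure_iff_nhds_not_empty)
  then have "closure D = UNIV"
    by blast
  with D(1) show ?thesis
    by (auto simp: separable_space_def)
qed

text \<open>The product type is the external orthogonal direct sum.\<close>

instantiation prod :: (complex_vector, complex_vector) complex_vector
begin

definition scaleC_prod_def: "c *\<^sub>C p = (c *\<^sub>C fst p, c *\<^sub>C snd p)"

instance
  by standard
    (simp_all add: scaleC_prod_def scaleC_add_right scaleC_add_left scaleC_scaleC scaleC_one
      scaleR_prod_def scaleR_eq_scaleC)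

end

instantiation prod :: (complex_inner, complex_inner) complex_inner
begin

definition cinner_prod_def: "cinner p q = cinner (fst p) (fst q) + cinner (snd p) (snd q)"

instance
proof
  fix x y z :: "'a \<times> 'b" and c :: complex
  show "cinner x y = cnj (cinner y x)"
    unfolding cinner_prod_def complex_cnj_add by (metis cinner_commute)
  show "cinner (x + y) z = cinner x z + cinner y z"
    by (simp add: cinner_prod_def cinner_add_left)
  show "cinner (c *\<^sub>C x) y = c * cinner x y"
    by (simp add: cinner_prod_def scaleC_prod_def cinner_scaleC_left distrib_left)
  show "inner x y = Re (cinner x y)"
    by (simp add: cinner_prod_def inner_prod_def inner_eq_Re_cinner)
qed

end

instance prod :: (chilbert, chilbert) chilbert
proof
  obtain A :: "'a set" where A: "countable A" "closure A = UNIV"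
    using chilbert_separable[where 'a = 'a] by (auto simp: separable_space_def)
  obtain B :: "'b set" where B: "countable B" "closure B = UNIV"
    using chilbert_separable[where 'a = 'b] by (auto simp: separable_space_def)
  have "countable (A \<times> B)" "closure (A \<times> B) = UNIV"
    using A B by (simp_all add: closure_Times)
  moreover have "D \<inter> U \<noteq> {}" if "closure D = UNIV" "open U" "U \<noteq> {}" for D U :: "('a \<times> 'b) set"
    using that open_Int_closure_eq_empty[of U D] by blast
  ultimately show "\<exists>D::('a \<times> 'b) set. countable D \<and> (\<forall>U. open U \<and> U \<noteq> {} \<longrightarrow> D \<inter> U \<noteq> {})"
    by blast
qed

section \<open>Bounded operators\<close>

definition bounded_clinear :: "('a::complex_inner \<Rightarrow> 'b::complex_inner) \<Rightarrow> bool" where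
  "bounded_clinear f \<longleftrightarrow> bounded_linear f \<and> (\<forall>c x. f (c *\<^sub>C x) = c *\<^sub>C f x)"

definition shift_op :: "('a::complex_inner \<Rightarrow> 'a) \<Rightarrow> complex \<Rightarrow> 'a \<Rightarrow> 'a" where
  "shift_op T w = (\<lambda>x. T x - w *\<^sub>C x)"

definition op_kernel :: "('a::complex_inner \<Rightarrow> 'b::complex_inner) \<Rightarrow> 'a set" where
  "op_kernel T = {x. T x = 0}"

definition op_spectrum :: "('a::complex_inner \<Rightarrow> 'a) \<Rightarrow> complex set" where
  "op_spectrum T =
    {w. \<not> (\<exists>R. bounded_clinear R \<and> R \<circ> shift_op T w = id \<and> shift_op T w \<circ> R = id)}"

definition orthogonal_projection :: "('a::complex_inner \<Rightarrow> 'a) \<Rightarrow> bool" where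
  "orthogonal_projection P \<longleftrightarrow>
    bounded_clinear P \<and> P \<circ> P = P \<and> (\<forall>x y. cinner (P x) y = cinner x (P y))"

definition irreducible_op :: "('a::complex_inner \<Rightarrow> 'a) \<Rightarrow> bool" where
  "irreducible_op T \<longleftrightarrow>
    (\<forall>P. orthogonal_projection P \<and> P \<circ> T = T \<circ> P \<longrightarrow> P = (\<lambda>x. 0) \<or> P = id)"

definition strongly_irreducible_op :: "('a::complex_inner \<Rightarrow> 'a) \<Rightarrow> bool" where
  "strongly_irreducible_op T \<longleftrightarrow>
    (\<forall>P. bounded_clinear P \<and> P \<circ> P = P \<and> P \<circ> T = T \<circ> P \<longrightarrow> P = (\<lambda>x. 0) \<or> P = id)"

section \<open>Cowen-Douglas operators\<close>

definition cowen_douglas1 :: "complex set \<Rightarrow> ('a::chilbert \<Rightarrow> 'a) set" where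
  "cowen_douglas1 \<Omega> = {T. bounded_clinear T \<and>
    \<Omega> \<subseteq> op_spectrum T \<and>
    (\<forall>w\<in>\<Omega>. range (shift_op T w) = UNIV) \<and>
    closure (cspan (\<Union>w\<in>\<Omega>. op_kernel (shift_op T w))) = UNIV \<and>
    (\<forall>w\<in>\<Omega>. cdim (op_kernel (shift_op T w)) = 1)}"

text \<open>The operator matrix with rows \<open>(A, B)\<close> and \<open>(0, D)\<close>.\<close>

definition upper_block :: "('a::complex_inner \<Rightarrow> 'a) \<Rightarrow> ('b::complex_inner \<Rightarrow> 'a) \<Rightarrow> ('b \<Rightarrow> 'b)
    \<Rightarrow> 'a \<times> 'b \<Rightarrow> 'a \<times> 'b" where
  "upper_block A B D = (\<lambda>(x, y). (A x + B y, D y))"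

definition FB2 :: "complex set \<Rightarrow> ('a::chilbert \<times> 'b::chilbert \<Rightarrow> 'a \<times> 'b) set" where
  "FB2 \<Omega> = {upper_block T0 S T1 | T0 S T1.
    T0 \<in> cowen_douglas1 \<Omega> \<and> T1 \<in> cowen_douglas1 \<Omega> \<and>
    bounded_clinear S \<and> S \<noteq> (\<lambda>y. 0) \<and> T0 \<circ> S = S \<circ> T1}"

end

theory Submission
  imports Defs
begin

text \<open>
  Compare the entries of \<open>P T = T P\<close> for a block operator \<open>P = (A, B; C, D)\<close>. By a
  Kleinecke--Shirokov argument \<open>S C = [A, T\<^sub>0]\<close> and \<open>C S = [T\<^sub>1, D]\<close> vanish, since they commute
  with \<open>T\<^sub>0\<close> and \<open>T\<^sub>1\<close>. A self-adjoint or idempotent operator in the commutant of an operator in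
  \<open>B\<^sub>1(\<Omega>)\<close> has a locally constant eigenvalue on the eigenvectors and hence is scalar, so \<open>A = a I\<close>
  and \<open>D = d I\<close> for a projection \<open>P\<close>. Then \<open>B C = (a - a\<^sup>2) I\<close> together with \<open>C S = 0\<close> and
  \<open>S \<noteq> 0\<close> forces \<open>a \<in> {0, 1}\<close>, after which \<open>C = B\<^sup>* = 0\<close> and \<open>(a - d) S = 0\<close>.
  When \<open>S = I\<close> and \<open>P\<close> is merely idempotent, \<open>C\<close> and \<open>D - A\<close> are such commutators,
  so \<open>A = D = a I\<close> with \<open>a \<in> {0, 1}\<close>, and \<open>2 a B = B\<close> gives \<open>B = 0\<close>.
\<close>

section \<open>Open mapping theorem\<close>

text \<open>By Baire, the closure of the image of some ball has interior points. Approximating two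
  points of an interior ball and rescaling the difference gives the approximate preimage.\<close>

lemma surj_bounded_linear_approx:
  fixes f :: "'a::real_normed_vector \<Rightarrow> 'b::banach"
  assumes "bounded_linear f" "surj f"
  shows "\<exists>M\<ge>0. \<forall>y. \<exists>x. norm x \<le> M * norm y \<and> norm (y - f x) \<le> norm y / 2"
proof -
  interpret f: bounded_linear f by fact
  define B where "B n = closure (f ` cball 0 (real n))" for n
  have "\<exists>n. y \<in> B n" for y
  proof -
    obtain x where "y = f x" using \<open>surj f\<close> by auto
    moreover obtain n where "norm x \<le> real n" using real_arch_simple by blast
    ultimately have "y \<in> f ` cball 0 (real n)" by simp
    then show ?thesis unfolding B_def using closure_subset by blast
  qed
  then have un: "\<Union>(range B) = UNIV" by blast
  have "\<exists>n. interior (B n) \<noteq> {}"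
  proof (rule ccontr)
    assume "\<not> ?thesis"
    then have "euclidean interior_of \<Union>(range B) = {}"
      by (intro Baire_category_alt) (auto simp: B_def completely_metrizable_space_euclidean)
    then show False by (simp add: un)
  qed
  then obtain n y0 where "y0 \<in> interior (B n)" by blast
  then obtain r where r: "r > 0" "ball y0 r \<subseteq> B n"
    using mem_interior by blast
  \<comment> \<open>With \<open>t * norm y = r / 2\<close> the point
    \<open>y0 + t *\<^sub>R y\<close> stays in the ball, two errors of \<open>r / 8\<close> divided
    by \<open>t\<close> give \<open>norm y / 2\<close>, and
    \<open>norm (x1 - x2) \<le> 2 * real n\<close> divided by \<open>t\<close> gives this
    \<open>M\<close>.\<close>
  define M where "M = 4 * real n / r"
  have "\<exists>x. norm x \<le> M * norm y \<and> norm (y - f x) \<le> norm y / 2" for y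
  proof (cases "y = 0")
    case True
    then show ?thesis by (intro exI[of _ 0]) (simp add: f.zero)
  next
    case False
    define t where "t = r / (2 * norm y)"
    have t: "t > 0" "t * norm y = r / 2" using False r by (auto simp: t_def)
    have "y0 + t *\<^sub>R y \<in> B n" "y0 \<in> B n"
      using r t by (auto simp: dist_norm intro!: subsetD[OF r(2)])
    moreover have "r / 8 > 0" using r by simp
    ultimately have "\<exists>x\<in>cball 0 (real n). dist (f x) (y0 + t *\<^sub>R y) < r / 8"
      and "\<exists>x\<in>cball 0 (real n). dist (f x) y0 < r / 8"
      unfolding B_def closure_approachable by blast+
    then obtain x1 x2 where x: "norm x1 \<le> n" "dist (f x1) (y0 + t *\<^sub>R y) < r / 8"
      "norm x2 \<le> n" "dist (f x2) y0 < r / 8"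
      by auto
    define x where "x = (1 / t) *\<^sub>R (x1 - x2)"
    have "y - f x = (1 / t) *\<^sub>R ((f x2 - y0) - (f x1 - (y0 + t *\<^sub>R y)))"
      using t by (simp add: x_def f.scaleR f.diff algebra_simps)
    also have "norm \<dots> \<le> (1 / t) * (r / 4)"
      using t x(2,4) norm_triangle_ineq4[of "f x2 - y0" "f x1 - (y0 + t *\<^sub>R y)"]
      by (auto simp: dist_norm divide_simps)
    also have "\<dots> = norm y / 2"
      using t by (simp add: field_simps)
    finally have 1: "norm (y - f x) \<le> norm y / 2" .
    have "norm x \<le> (1 / t) * (2 * real n)"
      using t x(1,3) norm_triangle_ineq4[of x1 x2] by (auto simp: x_def divide_simps)
    also have "\<dots> = M * norm y" using r False by (simp add: M_def t_def field_simps)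
    finally show ?thesis using 1 by blast
  qed
  moreover have "M \<ge> 0" using r by (simp add: M_def)
  ultimately show ?thesis by blast
qed

text \<open>Each approximate solution at least halves the residual, so the successive corrections
  form an absolutely convergent series, whose sum is an exact preimage.\<close>

lemma surj_bounded_linear_open:
  fixes f :: "'a::banach \<Rightarrow> 'b::banach"
  assumes "bounded_linear f" "surj f"
  shows "\<exists>C>0. \<forall>y. \<exists>x. f x = y \<and> norm x \<le> C * norm y"
proof -
  interpret f: bounded_linear f by fact
  obtain M where M: "M \<ge> 0"
    and "\<forall>y. \<exists>x. norm x \<le> M * norm y \<and> norm (y - f x) \<le> norm y / 2"
    using surj_bounded_linear_approx[OF assms] by blast
  then obtain g where g: "norm (g y) \<le> M * norm y" "norm (y - f (g y)) \<le> norm y / 2" for y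
    by metis
  \<comment> \<open>The geometric series contributes the factor 2; the extra 1 keeps the constant
    positive when \<open>M = 0\<close>.\<close>
  have "\<exists>x. f x = y \<and> norm x \<le> (2 * M + 1) * norm y" for y
  proof -
    define s where "s n = ((\<lambda>y. y - f (g y)) ^^ n) y" for n
    have s: "norm (s n) \<le> norm y * (1 / 2) ^ n" for n
    proof (induction n)
      case (Suc n)
      then show ?case using g(2)[of "s n"] by (simp add: s_def)
    qed (simp add: s_def)
    have gs: "norm (g (s n)) \<le> M * norm y * (1 / 2) ^ n" for n
      using order_trans[OF g(1) mult_left_mono[OF s M]] by (simp add: mult.assoc)
    have sm: "summable (\<lambda>n. M * norm y * (1 / 2) ^ n)"
      by (intro summable_mult summable_geometric) simp
    have sg: "summable (\<lambda>n. g (s n))"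
      using sm gs by (rule summable_comparison_test'[where N = 0])
    define x where "x = (\<Sum>n. g (s n))"
    have "s \<longlonglongrightarrow> 0"
      by (rule Lim_null_comparison[where g = "\<lambda>n. norm y * (1 / 2) ^ n"])
        (use s in \<open>auto intro!: tendsto_mult_right_zero LIMSEQ_power_zero\<close>)
    from telescope_sums'[OF this] have "(\<lambda>n. s n - s (Suc n)) sums y"
      by (simp add: s_def)
    moreover have "s n - s (Suc n) = f (g (s n))" for n by (simp add: s_def)
    ultimately have "(\<lambda>n. f (g (s n))) sums y" by simp
    moreover have "(\<lambda>n. f (g (s n))) sums f x"
      unfolding x_def by (rule f.sums[OF summable_sums[OF sg]])
    ultimately have "f x = y" by (rule sums_unique2[symmetric])
    moreover have "norm x \<le> (\<Sum>n. M * norm y * (1 / 2) ^ n)"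
      unfolding x_def using gs sm by (rule norm_suminf_le)
    then have "norm x \<le> 2 * M * norm y"
      by (subst (asm) suminf_mult) (auto simp: suminf_geometric)
    then have "norm x \<le> (2 * M + 1) * norm y" using M by (simp add: algebra_simps add_increasing)
    ultimately show ?thesis by blast
  qed
  then show ?thesis using M by (intro exI[of _ "2 * M + 1"]) auto
qed

section \<open>Bounded complex-linear maps\<close>

instance chilbert \<subseteq> banach ..

text \<open>The norm comes from the real inner product, so homogeneity for complex scalars has to be
  recovered from \<open>cinner\<close>.\<close>

lemma norm_scaleC: "norm (c *\<^sub>C x) = cmod c * norm (x::'a::complex_inner)"
proof -
  have "cinner (c *\<^sub>C x) (c *\<^sub>C x) = c * cnj c * cinner x x"
    by (metis cinner_commute cinner_scaleC_left complex_cnj_mult mult.assoc)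
  also have "c * cnj c = complex_of_real ((cmod c)\<^sup>2)"
    by (simp only: complex_norm_square)
  finally have "(norm (c *\<^sub>C x))\<^sup>2 = (cmod c * norm x)\<^sup>2"
    by (simp add: power2_norm_eq_inner inner_eq_Re_cinner power_mult_distrib)
  then show ?thesis by (simp add: power2_eq_iff_nonneg)
qed

lemma cinner_scaleC_right: "cinner x (c *\<^sub>C y) = cnj c * cinner (x::'a::complex_inner) y"
  by (metis cinner_commute cinner_scaleC_left complex_cnj_mult)

lemma cinner_zero_left [simp]: "cinner 0 (y::'a::complex_inner) = 0"
  using cinner_scaleC_left[of 0 0 y] by simp

lemma cinner_zero_right [simp]: "cinner (x::'a::complex_inner) 0 = 0"
  using cinner_scaleC_right[of x 0 0] by simp

lemma cinner_self_eq_0: "cinner x x = 0 \<Longrightarrow> (x::'a::complex_inner) = 0"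
  using inner_eq_Re_cinner[of x x] by (metis inner_eq_zero_iff zero_complex.sel(1))

lemma bounded_clinearD: "bounded_clinear f \<Longrightarrow> bounded_linear f"
  and bounded_clinear_scaleC: "bounded_clinear f \<Longrightarrow> f (c *\<^sub>C x) = c *\<^sub>C f x"
  by (simp_all add: bounded_clinear_def)

lemma bounded_clinear_add_apply: "bounded_clinear f \<Longrightarrow> f (x + y) = f x + f y"
  and bounded_clinear_diff_apply: "bounded_clinear f \<Longrightarrow> f (x - y) = f x - f y"
  and bounded_clinear_zero_apply: "bounded_clinear f \<Longrightarrow> f 0 = 0"
  by (simp_all add: bounded_clinear_def linear_add linear_diff linear_0 bounded_linear.linear)

lemmas bounded_clinear_apply = bounded_clinear_scaleC bounded_clinear_add_apply
  bounded_clinear_diff_apply bounded_clinear_zero_apply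

lemma bounded_clinear_scaleC_right:
  "bounded_clinear (\<lambda>x::'a::complex_inner. c *\<^sub>C x)"
  unfolding bounded_clinear_def
proof (intro conjI allI)
  show "bounded_linear (\<lambda>x::'a. c *\<^sub>C x)"
    by (rule bounded_linear_intro[where K = "cmod c"])
      (simp_all add: scaleC_add_right scaleR_eq_scaleC scaleC_scaleC norm_scaleC mult.commute)
qed (simp add: scaleC_scaleC mult.commute)

lemma bounded_clinear_compose:
  "bounded_clinear f \<Longrightarrow> bounded_clinear g \<Longrightarrow> bounded_clinear (\<lambda>x. f (g x))"
  by (simp add: bounded_clinear_def bounded_linear_compose)

lemma bounded_clinear_diff:
  "bounded_clinear f \<Longrightarrow> bounded_clinear g \<Longrightarrow> bounded_clinear (\<lambda>x. f x - g x)"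
  by (simp add: bounded_clinear_def bounded_linear_sub complex_vector.scale_right_diff_distrib)

lemma bounded_clinear_zero: "bounded_clinear (\<lambda>x. 0)"
  by (simp add: bounded_clinear_def)

lemma bounded_clinear_shift_op: "bounded_clinear T \<Longrightarrow> bounded_clinear (shift_op T w)"
  unfolding shift_op_def by (intro bounded_clinear_diff bounded_clinear_scaleC_right)

lemma bounded_clinear_fst: "bounded_clinear fst"
  and bounded_clinear_snd: "bounded_clinear snd"
  by (simp_all add: bounded_clinear_def bounded_linear_fst bounded_linear_snd scaleC_prod_def)

lemma bounded_clinear_Pair_left: "bounded_clinear (\<lambda>x. (x, 0))"
  and bounded_clinear_Pair_right: "bounded_clinear (\<lambda>y. (0, y))"
  by (simp_all add: bounded_clinear_def scaleC_prod_def bounded_linear_Pair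
      bounded_linear_ident bounded_linear_zero)

section \<open>Eigenvectors\<close>

text \<open>
  Solving \<open>(T - w\<^sub>0) e\<^sub>n\<^sub>+\<^sub>1 = e\<^sub>n\<close> with \<open>e\<^sub>0 = v\<^sub>0\<close> and geometrically bounded \<open>e\<^sub>n\<close>, the vector
  \<open>\<Sum>n. (w - w\<^sub>0)\<^sup>n e\<^sub>n\<close> is an eigenvector for \<open>w\<close>.
\<close>

lemma eigenvector_perturbation:
  fixes T :: "'a::chilbert \<Rightarrow> 'a"
  assumes T: "bounded_clinear T" and surj: "surj (shift_op T w0)"
    and v0: "T v0 = w0 *\<^sub>C v0" and "\<epsilon> > 0"
  shows "\<exists>\<delta>>0. \<forall>w. dist w w0 < \<delta> \<longrightarrow> (\<exists>v. T v = w *\<^sub>C v \<and> norm (v - v0) \<le> \<epsilon>)"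
proof -
  let ?U = "shift_op T w0"
  have U: "bounded_clinear ?U" using T by (rule bounded_clinear_shift_op)
  interpret U: bounded_linear ?U using U by (rule bounded_clinearD)
  obtain C where C: "C > 0" and "\<forall>y. \<exists>x. ?U x = y \<and> norm x \<le> C * norm y"
    using surj_bounded_linear_open[OF bounded_clinearD[OF U] surj] by blast
  then obtain h where h: "?U (h y) = y" "norm (h y) \<le> C * norm y" for y by metis
  define e where "e n = (h ^^ n) v0" for n
  have e0: "?U (e 0) = 0" and eSuc: "?U (e (Suc n)) = e n" for n
    using v0 h by (simp_all add: e_def shift_op_def)
  have e: "norm (e n) \<le> C ^ n * norm v0" for n
  proof (induction n)
    case (Suc n)
    then show ?case
      using order_trans[OF h(2) mult_left_mono[OF Suc]] C by (simp add: e_def mult.assoc)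
  qed (simp add: e_def)
  \<comment> \<open>The first bound gives \<open>q < 1 / 2\<close>, hence
    \<open>1 / (1 - q) \<le> 2\<close>; the second then keeps the tail after \<open>v0\<close>
    within \<epsilon>. Adding 1 to \<open>norm v0\<close> covers \<open>v0 = 0\<close>.\<close>
  define \<delta> where "\<delta> = min (1 / (2 * C)) (\<epsilon> / (2 * C * (norm v0 + 1)))"
  have "\<exists>v. T v = w *\<^sub>C v \<and> norm (v - v0) \<le> \<epsilon>" if w: "dist w w0 < \<delta>" for w
  proof -
    define z where "z = w - w0"
    define q where "q = cmod z * C"
    have z: "cmod z < \<delta>" using w by (simp add: z_def dist_norm)
    have q: "0 \<le> q" "q < 1 / 2" "2 * q * (norm v0 + 1) \<le> \<epsilon>"
    proof -
      show "0 \<le> q" using C by (simp add: q_def)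
      show "q < 1 / 2" using C z by (simp add: q_def \<delta>_def field_simps)
      have "cmod z \<le> \<epsilon> / (2 * C * (norm v0 + 1))" using z by (simp add: \<delta>_def)
      then have "cmod z * (2 * C * (norm v0 + 1)) \<le> \<epsilon>"
        using C by (subst (asm) pos_le_divide_eq) (auto intro!: mult_pos_pos add_nonneg_pos)
      then show "2 * q * (norm v0 + 1) \<le> \<epsilon>" by (simp add: q_def mult_ac)
    qed
    have bd: "norm (z ^ n *\<^sub>C e n) \<le> norm v0 * q ^ n" for n
      using mult_left_mono[OF e[of n], of "cmod z ^ n"]
      by (simp add: norm_scaleC norm_power q_def power_mult_distrib mult_ac)
    have sm: "summable (\<lambda>n. norm v0 * q ^ n)"
      using q by (intro summable_mult summable_geometric) simp
    have se: "summable (\<lambda>n. z ^ n *\<^sub>C e n)"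
      using sm bd by (rule summable_comparison_test'[where N = 0])
    define v where "v = (\<Sum>n. z ^ n *\<^sub>C e n)"
    have v: "v = v0 + (\<Sum>n. z ^ Suc n *\<^sub>C e (Suc n))"
      using suminf_split_head[OF se] by (simp add: v_def e_def scaleC_one)
    have se': "summable (\<lambda>n. z ^ Suc n *\<^sub>C e (Suc n))"
      using se by (subst summable_Suc_iff)
    \<comment> \<open>\<open>?U\<close> lowers the index of \<open>e\<close> by one, so it sends the
      tail of the series to \<open>z\<close> times the whole series.\<close>
    have "(\<lambda>n. ?U (z ^ Suc n *\<^sub>C e (Suc n))) sums ?U (v - v0)"
      using U.sums[OF summable_sums[OF se']] by (simp add: v)
    then have "(\<lambda>n. z *\<^sub>C (z ^ n *\<^sub>C e n)) sums ?U (v - v0)"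
      by (simp only: bounded_clinear_scaleC[OF U] eSuc scaleC_scaleC power_Suc)
    moreover have "(\<lambda>n. z *\<^sub>C (z ^ n *\<^sub>C e n)) sums (z *\<^sub>C v)"
      unfolding v_def
      by (rule bounded_linear.sums[OF bounded_clinearD[OF bounded_clinear_scaleC_right]
            summable_sums[OF se]])
    ultimately have "?U (v - v0) = z *\<^sub>C v" by (rule sums_unique2)
    then have "?U v = z *\<^sub>C v" using e0 by (simp add: U.diff e_def)
    then have "T v = w *\<^sub>C v"
      by (simp add: shift_op_def z_def complex_vector.scale_left_diff_distrib)
    moreover have "norm (v - v0) \<le> \<epsilon>"
    proof -
      have sm': "summable (\<lambda>n. norm v0 * q * q ^ n)"
        using q by (intro summable_mult summable_geometric) simp
      have "norm (v - v0) \<le> (\<Sum>n. norm v0 * q * q ^ n)"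
        unfolding v add_diff_cancel_left'
      proof (rule norm_suminf_le[OF _ sm'])
        show "norm (z ^ Suc n *\<^sub>C e (Suc n)) \<le> norm v0 * q * q ^ n" for n
          using bd[of "Suc n"] by (simp add: mult.assoc)
      qed
      also have "\<dots> = norm v0 * q * (1 / (1 - q))"
        using q by (subst suminf_mult) (auto simp: suminf_geometric)
      also have "\<dots> \<le> norm v0 * q * 2"
        using q by (intro mult_left_mono) (auto simp: divide_simps)
      also have "\<dots> \<le> \<epsilon>" using q by (simp add: algebra_simps)
      finally show ?thesis .
    qed
    ultimately show ?thesis by blast
  qed
  moreover have "\<delta> > 0" using C \<open>\<epsilon> > 0\<close>
    by (auto simp: \<delta>_def intro!: divide_pos_pos mult_pos_pos add_nonneg_pos)
  ultimately show ?thesis by blast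
qed

section \<open>Eigenspaces of operators in B_1(\<Omega>) and density of their span\<close>

lemma cowen_douglas1_clinear: "T \<in> cowen_douglas1 \<Omega> \<Longrightarrow> bounded_clinear T"
  by (simp add: cowen_douglas1_def)

lemma cowen_douglas1_surj: "T \<in> cowen_douglas1 \<Omega> \<Longrightarrow> w \<in> \<Omega> \<Longrightarrow> surj (shift_op T w)"
  by (simp add: cowen_douglas1_def)

lemma cowen_douglas1_eigenspace:
  assumes "T \<in> cowen_douglas1 \<Omega>" "w \<in> \<Omega>"
  obtains v where "v \<noteq> 0" "T v = w *\<^sub>C v" "\<And>u. T u = w *\<^sub>C u \<Longrightarrow> \<exists>c. u = c *\<^sub>C v"
proof -
  let ?K = "op_kernel (shift_op T w)"
  have "cdim ?K = 1" using assms by (simp add: cowen_douglas1_def)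
  then obtain B where B: "B \<subseteq> ?K" "\<not> complex_vector.dependent B" "?K \<subseteq> cspan B" "card B = 1"
    using complex_vector.basis_exists[of ?K] by metis
  then obtain v where "B = {v}" by (auto simp: card_1_singleton_iff)
  with B have "v \<noteq> 0" "v \<in> ?K" "?K \<subseteq> range (\<lambda>k. k *\<^sub>C v)"
    by (auto simp: complex_vector.span_singleton)
  then show thesis by (intro that[of v]) (auto simp: op_kernel_def shift_op_def)
qed

text \<open>The set where \<open>A\<close> and \<open>B\<close> agree is a closed complex subspace,
  and the eigenvectors span a dense one.\<close>

lemma cowen_douglas1_ext:
  fixes T :: "'a::chilbert \<Rightarrow> 'a" and A B :: "'a \<Rightarrow> 'b::chilbert"
  assumes T: "T \<in> cowen_douglas1 \<Omega>" and A: "bounded_clinear A" and B: "bounded_clinear B"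
    and eq: "\<And>w v. w \<in> \<Omega> \<Longrightarrow> T v = w *\<^sub>C v \<Longrightarrow> A v = B v"
  shows "A x = B x"
proof -
  let ?E = "\<Union>w\<in>\<Omega>. op_kernel (shift_op T w)"
  have "cspan ?E \<subseteq> {x. A x = B x}"
  proof (rule complex_vector.span_minimal)
    show "?E \<subseteq> {x. A x = B x}" using eq by (auto simp: op_kernel_def shift_op_def)
    show "complex_vector.subspace {x. A x = B x}"
      unfolding complex_vector.subspace_def
      by (simp add: bounded_clinear_apply[OF A] bounded_clinear_apply[OF B])
  qed
  moreover have "closed {x. A x = B x}"
    using A B by (intro closed_Collect_eq linear_continuous_on bounded_clinearD)
  ultimately have "closure (cspan ?E) \<subseteq> {x. A x = B x}" by (rule closure_minimal)
  moreover have "closure (cspan ?E) = UNIV" using T by (simp add: cowen_douglas1_def)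
  ultimately show ?thesis by blast
qed

text \<open>Commuting with \<open>T\<close>, the operator \<open>A\<close> preserves the kernel of
  \<open>T - w\<close>, which is a line.\<close>

lemma cowen_douglas1_commutant_eigen:
  assumes T: "T \<in> cowen_douglas1 \<Omega>" "w \<in> \<Omega>"
    and A: "bounded_clinear A" "\<And>x. A (T x) = T (A x)"
  shows "\<exists>a. \<forall>v. T v = w *\<^sub>C v \<longrightarrow> A v = a *\<^sub>C v"
proof -
  obtain v where v: "v \<noteq> 0" "T v = w *\<^sub>C v" "\<And>u. T u = w *\<^sub>C u \<Longrightarrow> \<exists>c. u = c *\<^sub>C v"
    using cowen_douglas1_eigenspace[OF T] by blast
  have "T (A v) = w *\<^sub>C A v" using A v(2) by (metis bounded_clinear_scaleC)
  then obtain a where a: "A v = a *\<^sub>C v" using v(3) by blast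
  have "A u = a *\<^sub>C u" if "T u = w *\<^sub>C u" for u
  proof -
    obtain c where "u = c *\<^sub>C v" using v(3) \<open>T u = w *\<^sub>C u\<close> by blast
    then show ?thesis by (simp add: bounded_clinear_scaleC[OF A(1)] a scaleC_scaleC mult.commute)
  qed
  then show ?thesis by blast
qed

section \<open>Commutators and the commutant\<close>

text \<open>The terms \<open>(b / a) ^ n / fact n\<close> of the exponential series tend to 0, so
  they cannot all be at least 1.\<close>

lemma fact_power_unbounded:
  fixes a b :: real
  assumes "a > 0"
  shows "\<exists>n. fact n * a ^ n > b ^ n"
proof (rule ccontr)
  assume "\<not> ?thesis"
  then have *: "1 \<le> (b / a) ^ n / fact n" for n
    using assms by (auto simp: power_divide field_simps not_less)
  have "(\<lambda>n. (b / a) ^ n / fact n) \<longlonglongrightarrow> 0"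
    using summable_LIMSEQ_zero[OF summable_exp[of "b / a"]] by (simp add: divide_inverse mult.commute)
  then have "(1::real) \<le> 0" using * by (intro tendsto_lowerbound[where F = sequentially]) auto
  then show False by simp
qed

text \<open>
  The Kleinecke--Shirokov argument: if \<open>N v = \<phi> v\<close> on an eigenvector, then
  \<open>(T - w)\<^sup>n A\<^sup>n v = (-1)\<^sup>n n! \<phi>\<^sup>n v\<close>, which contradicts boundedness unless \<open>\<phi> = 0\<close>.
\<close>

lemma commutator_in_commutant_eq_0:
  fixes T :: "'a::chilbert \<Rightarrow> 'a"
  assumes T: "T \<in> cowen_douglas1 \<Omega>" and A: "bounded_clinear A" and N: "bounded_clinear N"
    and AT: "\<And>x. A (T x) = T (A x) + N x" and NT: "\<And>x. N (T x) = T (N x)"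
  shows "N x = 0"
proof (rule cowen_douglas1_ext[OF T N bounded_clinear_zero])
  fix w v assume w: "w \<in> \<Omega>" and v: "T v = w *\<^sub>C v"
  obtain \<phi> where "\<forall>v. T v = w *\<^sub>C v \<longrightarrow> N v = \<phi> *\<^sub>C v"
    using cowen_douglas1_commutant_eigen[OF T w N, OF NT] ..
  with v have \<phi>: "N v = \<phi> *\<^sub>C v" by simp
  define U where "U = shift_op T w"
  have U: "bounded_clinear U" unfolding U_def
    by (intro bounded_clinear_shift_op cowen_douglas1_clinear[OF T])
  have AU: "A (U x) = U (A x) + N x" and NU: "N (U x) = U (N x)" for x
    by (simp_all add: U_def shift_op_def bounded_clinear_apply[OF A] bounded_clinear_apply[OF N]
        AT NT)
  have Uv: "U v = 0" by (simp add: U_def shift_op_def v)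
  have NUn: "N ((U ^^ n) x) = (U ^^ n) (N x)" for n x
    by (induction n) (simp_all add: NU)
  \<comment> \<open>Moving \<open>A\<close> past each of the \<open>Suc n\<close> factors
    \<open>U\<close> costs one \<open>N\<close>, and these terms agree because \<open>N\<close>
    commutes with \<open>U\<close>.\<close>
  have UA: "(U ^^ Suc n) (A x) = A ((U ^^ Suc n) x) - of_nat (Suc n) *\<^sub>C (U ^^ n) (N x)" for n x
  proof (induction n)
    case 0
    then show ?case by (simp add: AU scaleC_one)
  next
    case (Suc n)
    have "(U ^^ Suc (Suc n)) (A x) = U ((U ^^ Suc n) (A x))" by simp
    also have "\<dots> = U (A ((U ^^ Suc n) x)) - of_nat (Suc n) *\<^sub>C (U ^^ Suc n) (N x)"
      by (subst Suc) (simp add: bounded_clinear_apply[OF U])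
    also have "U (A ((U ^^ Suc n) x)) = A ((U ^^ Suc (Suc n)) x) - (U ^^ Suc n) (N x)"
      using AU[of "(U ^^ Suc n) x"] NUn[of "Suc n" x] by simp
    finally show ?case
      by (simp only: of_nat_Suc[of "Suc n"] scaleC_add_left scaleC_one diff_diff_eq)
  qed
  have key: "(U ^^ n) ((A ^^ n) v) = ((- 1) ^ n * fact n * \<phi> ^ n) *\<^sub>C v" for n
  proof (induction n)
    case 0
    then show ?case by (simp add: scaleC_one)
  next
    case (Suc n)
    \<comment> \<open>By induction \<open>U ^^ n\<close> sends \<open>(A ^^ n) v\<close> to a
      multiple of \<open>v\<close>, which \<open>U\<close> kills; hence only the \<open>N\<close>
      term of \<open>UA\<close> survives.\<close>
    have "(U ^^ Suc n) ((A ^^ n) v) = 0"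
      by (simp add: Suc bounded_clinear_apply[OF U] Uv)
    then have "(U ^^ Suc n) ((A ^^ Suc n) v) = - (of_nat (Suc n) *\<^sub>C N ((U ^^ n) ((A ^^ n) v)))"
      using UA[of n "(A ^^ n) v"] by (simp add: NUn bounded_clinear_apply[OF A])
    also have "\<dots> = ((- 1) ^ Suc n * fact (Suc n) * \<phi> ^ Suc n) *\<^sub>C v"
      by (simp add: Suc bounded_clinear_apply[OF N] \<phi> scaleC_scaleC mult_ac
          flip: complex_vector.scale_minus_left)
    finally show ?case .
  qed
  show "N v = 0"
  proof (rule ccontr)
    assume "N v \<noteq> 0"
    then have "v \<noteq> 0" "\<phi> \<noteq> 0" using \<phi> by auto
    obtain a where a: "a > 0" "\<And>x. norm (A x) \<le> norm x * a"
      using bounded_linear.pos_bounded[OF bounded_clinearD[OF A]] by blast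
    obtain b where b: "b > 0" "\<And>x. norm (U x) \<le> norm x * b"
      using bounded_linear.pos_bounded[OF bounded_clinearD[OF U]] by blast
    have An: "norm ((A ^^ n) x) \<le> a ^ n * norm x" for n x
      by (induction n) (use a in \<open>auto intro: order_trans[OF a(2)] simp: mult_ac\<close>)
    have Un: "norm ((U ^^ n) x) \<le> b ^ n * norm x" for n x
      by (induction n) (use b in \<open>auto intro: order_trans[OF b(2)] simp: mult_ac\<close>)
    have "fact n * cmod \<phi> ^ n \<le> (b * a) ^ n" for n
    proof -
      have "fact n * cmod \<phi> ^ n * norm v = norm ((U ^^ n) ((A ^^ n) v))"
        by (simp add: key norm_scaleC norm_mult norm_power)
      also have "\<dots> \<le> b ^ n * (a ^ n * norm v)"
        using order_trans[OF Un mult_left_mono[OF An]] b by simp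
      finally show ?thesis using \<open>v \<noteq> 0\<close> by (simp add: power_mult_distrib)
    qed
    moreover obtain n where "fact n * cmod \<phi> ^ n > (b * a) ^ n"
      using fact_power_unbounded[of "cmod \<phi>"] \<open>\<phi> \<noteq> 0\<close> by auto
    ultimately show False by (simp add: not_less[symmetric])
  qed
qed

section \<open>Scalar operators in the commutant\<close>

text \<open>
  The separation hypothesis holds both for self-adjoint and for idempotent \<open>A\<close>; it makes the
  eigenvalue of \<open>A\<close> on the kernel of \<open>T - w\<close> a locally constant function of \<open>w\<close>.
\<close>

lemma commutant_separated_eigenvectors_scalar:
  fixes T :: "'a::chilbert \<Rightarrow> 'a"
  assumes "connected \<Omega>" and T: "T \<in> cowen_douglas1 \<Omega>"
    and A: "bounded_clinear A" and AT: "\<And>x. A (T x) = T (A x)"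
    and K: "\<And>u v a b. A u = a *\<^sub>C u \<Longrightarrow> A v = b *\<^sub>C v \<Longrightarrow> a \<noteq> b \<Longrightarrow> norm u \<le> K * norm (v - u)"
  shows "\<exists>c. \<forall>x. A x = c *\<^sub>C x"
proof -
  have "\<forall>w\<in>\<Omega>. \<exists>a. \<forall>v. T v = w *\<^sub>C v \<longrightarrow> A v = a *\<^sub>C v"
    by (intro ballI cowen_douglas1_commutant_eigen[OF T _ A] AT)
  from bchoice[OF this] obtain \<phi> where
    "\<forall>w\<in>\<Omega>. \<forall>v. T v = w *\<^sub>C v \<longrightarrow> A v = \<phi> w *\<^sub>C v" ..
  then have \<phi>: "A v = \<phi> w *\<^sub>C v" if "w \<in> \<Omega>" "T v = w *\<^sub>C v" for w v
    using that by simp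
  have loc: "\<forall>\<^sub>F w in at w0 within \<Omega>. \<phi> w0 = \<phi> w" if w0: "w0 \<in> \<Omega>" for w0
  proof -
    obtain u where u: "u \<noteq> 0" "T u = w0 *\<^sub>C u"
      by (rule cowen_douglas1_eigenspace[OF T w0])
    \<comment> \<open>Small enough that an eigenvector within \<epsilon> of \<open>u\<close> cannot
      satisfy the separation bound; \<open>\<bar>K\<bar> + 1\<close> avoids a case split on the sign
      of \<open>K\<close>.\<close>
    define \<epsilon> where "\<epsilon> = norm u / (2 * (\<bar>K\<bar> + 1))"
    have \<epsilon>: "\<epsilon> > 0" "K * \<epsilon> < norm u"
    proof -
      show "\<epsilon> > 0" unfolding \<epsilon>_def using u by (intro divide_pos_pos) auto
      then have "K * \<epsilon> \<le> \<bar>K\<bar> * \<epsilon>" by (intro mult_right_mono) auto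
      also have "\<dots> < 2 * (\<bar>K\<bar> + 1) * \<epsilon>"
        using \<open>\<epsilon> > 0\<close> by (intro mult_strict_right_mono) auto
      also have "\<dots> = norm u" by (simp add: \<epsilon>_def)
      finally show "K * \<epsilon> < norm u" .
    qed
    obtain \<delta> where \<delta>: "\<delta> > 0"
      "\<And>w. dist w w0 < \<delta> \<Longrightarrow> \<exists>v. T v = w *\<^sub>C v \<and> norm (v - u) \<le> \<epsilon>"
      using eigenvector_perturbation[OF cowen_douglas1_clinear[OF T] cowen_douglas1_surj[OF T w0]
          u(2) \<epsilon>(1)] by blast
    have "\<phi> w0 = \<phi> w" if w: "w \<in> \<Omega>" "dist w w0 < \<delta>" for w
    proof (rule ccontr)
      assume ne: "\<phi> w0 \<noteq> \<phi> w"
      obtain v where v: "T v = w *\<^sub>C v" "norm (v - u) \<le> \<epsilon>" using \<delta>(2)[OF w(2)] by blast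
      have "norm u \<le> K * norm (v - u)"
        using K[OF \<phi>[OF w0 u(2)] \<phi>[OF w(1) v(1)] ne] .
      moreover have "0 < norm u" using u by simp
      ultimately have "K > 0" by (smt (verit) mult_nonpos_nonneg norm_ge_zero)
      then have "K * norm (v - u) \<le> K * \<epsilon>" using v by (intro mult_left_mono) auto
      then show False using \<open>norm u \<le> K * norm (v - u)\<close> \<epsilon> by simp
    qed
    then show ?thesis using \<delta>(1) by (auto simp: eventually_at)
  qed
  \<comment> \<open>Connectedness turns the locally constant eigenvalue into a single
    \<open>c\<close>; density of the eigenvectors then gives the identity everywhere.\<close>
  obtain c where c: "\<And>w. w \<in> \<Omega> \<Longrightarrow> \<phi> w = c"
    using connected_local_const[OF \<open>connected \<Omega>\<close>] loc by metis
  have "A x = c *\<^sub>C x" for x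
    by (rule cowen_douglas1_ext[OF T A bounded_clinear_scaleC_right]) (use \<phi> c in auto)
  then show ?thesis by blast
qed

text \<open>Eigenvectors of a self-adjoint operator for distinct eigenvalues are orthogonal, so
  Pythagoras gives the separation with \<open>K = 1\<close>.\<close>

lemma selfadjoint_commutant_scalar:
  fixes T :: "'a::chilbert \<Rightarrow> 'a"
  assumes "connected \<Omega>" and T: "T \<in> cowen_douglas1 \<Omega>"
    and A: "bounded_clinear A" and AT: "\<And>x. A (T x) = T (A x)"
    and sa: "\<And>x y. cinner (A x) y = cinner x (A y)"
  shows "\<exists>c. \<forall>x. A x = c *\<^sub>C x"
proof (rule commutant_separated_eigenvectors_scalar[OF assms(1-3), OF AT, where K = 1])
  fix u v a b assume u: "A u = a *\<^sub>C u" and v: "A v = b *\<^sub>C v" and "a \<noteq> b"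
  show "norm u \<le> 1 * norm (v - u)"
  proof (cases "u = 0")
    case False
    have "a * cinner u u = cnj a * cinner u u"
      using sa[of u u] by (simp add: u cinner_scaleC_left cinner_scaleC_right)
    then have "cnj a = a" using False cinner_self_eq_0[of u] by auto
    have "b * cinner v u = cnj a * cinner v u"
      using sa[of v u] by (simp add: u v cinner_scaleC_left cinner_scaleC_right)
    then have "cinner v u = 0" using \<open>cnj a = a\<close> \<open>a \<noteq> b\<close> by auto
    then have "inner v u = 0" by (simp add: inner_eq_Re_cinner)
    then have "(norm (v - u))\<^sup>2 = (norm v)\<^sup>2 + (norm u)\<^sup>2"
      by (simp add: power2_norm_eq_inner inner_diff_left inner_diff_right inner_commute)
    then have "(norm u)\<^sup>2 \<le> (norm (v - u))\<^sup>2" by simp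
    then show ?thesis using power2_le_imp_le by force
  qed simp
qed

text \<open>An idempotent has only the eigenvalues 0 and 1, so for distinct ones \<open>u\<close> is
  recovered from \<open>v - u\<close> by \<open>A - 1\<close> or \<open>- A\<close>, and the norm
  bound \<open>k\<close> of \<open>A\<close> yields \<open>K = 1 + k\<close>.\<close>

lemma idempotent_commutant_scalar:
  fixes T :: "'a::chilbert \<Rightarrow> 'a"
  assumes "connected \<Omega>" and T: "T \<in> cowen_douglas1 \<Omega>"
    and A: "bounded_clinear A" and AT: "\<And>x. A (T x) = T (A x)"
    and idem: "\<And>x. A (A x) = A x"
  shows "\<exists>c. \<forall>x. A x = c *\<^sub>C x"
proof -
  obtain k where k: "k > 0" "\<And>x. norm (A x) \<le> norm x * k"
    using bounded_linear.pos_bounded[OF bounded_clinearD[OF A]] by blast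
  have ev: "a = 0 \<or> a = 1" if "A u = a *\<^sub>C u" "u \<noteq> 0" for a u
  proof -
    have "a *\<^sub>C (a *\<^sub>C u) = a *\<^sub>C u"
      using idem[of u] by (simp add: that bounded_clinear_apply[OF A])
    then show ?thesis using that(2) by (simp add: scaleC_scaleC complex_vector.scale_right_imp_eq)
  qed
  show ?thesis
  proof (rule commutant_separated_eigenvectors_scalar[OF assms(1-3), OF AT, where K = "1 + k"])
    fix u v a b assume u: "A u = a *\<^sub>C u" and v: "A v = b *\<^sub>C v" and "a \<noteq> b"
    show "norm u \<le> (1 + k) * norm (v - u)"
    proof (cases "u = 0 \<or> v = 0")
      case True
      then show ?thesis using k(1) by (auto simp: algebra_simps)
    next
      case False
      then have "a = 0 \<and> b = 1 \<or> a = 1 \<and> b = 0" using ev[OF u] ev[OF v] \<open>a \<noteq> b\<close> by auto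
      then have "u = A (v - u) - (v - u) \<or> u = - A (v - u)"
        by (auto simp: u v bounded_clinear_apply[OF A] scaleC_one)
      then have "norm u \<le> norm (A (v - u)) + norm (v - u)"
        by (metis add_increasing2 norm_ge_zero norm_minus_cancel norm_triangle_ineq4 order_refl)
      then show ?thesis using k(2)[of "v - u"] by (simp add: algebra_simps)
    qed
  qed
qed

section \<open>Operator matrices\<close>

lemma bounded_clinear_blocks:
  fixes P :: "'a::complex_inner \<times> 'b::complex_inner \<Rightarrow> 'a \<times> 'b"
  assumes P: "bounded_clinear P"
  obtains A B C D where "bounded_clinear A" "bounded_clinear B" "bounded_clinear C"
    "bounded_clinear D" "\<And>x y. P (x, y) = (A x + B y, C x + D y)"
proof (rule that)
  note bc = bounded_clinear_compose[OF bounded_clinear_fst bounded_clinear_compose[OF P]]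
    bounded_clinear_compose[OF bounded_clinear_snd bounded_clinear_compose[OF P]]
  show "bounded_clinear (\<lambda>x. fst (P (x, 0)))" "bounded_clinear (\<lambda>y. fst (P (0, y)))"
    "bounded_clinear (\<lambda>x. snd (P (x, 0)))" "bounded_clinear (\<lambda>y. snd (P (0, y)))"
    by (intro bc bounded_clinear_Pair_left bounded_clinear_Pair_right)+
  show "P (x, y) = (fst (P (x, 0)) + fst (P (0, y)), snd (P (x, 0)) + snd (P (0, y)))" for x y
    using bounded_clinear_add_apply[OF P, of "(x, 0)" "(0, y)"] by (simp add: prod_eq_iff)
qed

section \<open>Projections commuting with an operator in FB_2(\<Omega>)\<close>

lemma FB2_irreducible:
  fixes T :: "'a::chilbert \<times> 'b::chilbert \<Rightarrow> 'a \<times> 'b"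
  assumes \<Omega>: "connected \<Omega>" and "T \<in> FB2 \<Omega>"
  shows "irreducible_op T"
  unfolding irreducible_op_def
proof (intro allI impI, elim conjE)
  fix P assume "orthogonal_projection P" and comm: "P \<circ> T = T \<circ> P"
  then have P: "bounded_clinear P" and "P \<circ> P = P"
    and sa: "\<And>p q. cinner (P p) q = cinner p (P q)"
    by (auto simp: orthogonal_projection_def)
  then have idem: "\<And>p. P (P p) = P p" by (metis comp_apply)
  obtain T0 S T1 where T: "T = upper_block T0 S T1"
    and T0: "T0 \<in> cowen_douglas1 \<Omega>" and T1: "T1 \<in> cowen_douglas1 \<Omega>"
    and S: "bounded_clinear S" and S_ne: "S \<noteq> (\<lambda>y. 0)" and TS: "\<And>y. T0 (S y) = S (T1 y)"
    using \<open>T \<in> FB2 \<Omega>\<close> by (auto simp: FB2_def fun_eq_iff)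
  obtain A B C D where A: "bounded_clinear A" and B: "bounded_clinear B"
    and C: "bounded_clinear C" and D: "bounded_clinear D"
    and PE: "\<And>x y. P (x, y) = (A x + B y, C x + D y)"
    using bounded_clinear_blocks[OF P] by blast
  note zero = bounded_clinear_zero_apply
  note [simp] = zero[OF A] zero[OF B] zero[OF C] zero[OF D] zero[OF S]
    zero[OF cowen_douglas1_clinear[OF T0]] zero[OF cowen_douglas1_clinear[OF T1]]
  have PT: "P (T p) = T (P p)" for p using comm by (metis comp_apply)
  have AT: "A (T0 x) = T0 (A x) + S (C x)" and CT: "C (T0 x) = T1 (C x)" for x
    using PT[of "(x, 0)"] by (simp_all add: T upper_block_def PE)
  have BT: "A (S y) + B (T1 y) = T0 (B y) + S (D y)" and DT: "T1 (D y) = D (T1 y) + C (S y)" for y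
    using PT[of "(0, y)"] by (simp_all add: T upper_block_def PE add.commute)
  have SC: "S (C x) = 0" for x
    by (rule commutator_in_commutant_eq_0[OF T0 A bounded_clinear_compose[OF S C], OF AT])
      (simp add: CT TS)
  \<comment> \<open>By \<open>DT\<close> the commutator of \<open>D\<close> with \<open>T1\<close>
    is minus \<open>C\<close> after \<open>S\<close>; the leading \<open>0 -\<close> carries that
    sign.\<close>
  have "0 - C (S y) = 0" for y
  proof (rule commutator_in_commutant_eq_0[OF T1 D
        bounded_clinear_diff[OF bounded_clinear_zero bounded_clinear_compose[OF C S]]])
    show "D (T1 y) = T1 (D y) + (0 - C (S y))" for y by (simp add: DT)
    show "0 - C (S (T1 y)) = T1 (0 - C (S y))" for y
      unfolding bounded_clinear_diff_apply[OF cowen_douglas1_clinear[OF T1]]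
      by (simp add: CT flip: TS)
  qed
  then have CS: "C (S y) = 0" for y by simp
  have saA: "cinner (A x) x' = cinner x (A x')" for x x'
    using sa[of "(x, 0)" "(x', 0)"] by (simp add: PE cinner_prod_def)
  have saD: "cinner (D y) y' = cinner y (D y')" for y y'
    using sa[of "(0, y)" "(0, y')"] by (simp add: PE cinner_prod_def)
  have adj: "cinner (C x) y = cinner x (B y)" for x y
    using sa[of "(x, 0)" "(0, y)"] by (simp add: PE cinner_prod_def)
  obtain a where a: "\<And>x. A x = a *\<^sub>C x"
    using selfadjoint_commutant_scalar[OF \<Omega> T0 A, OF _ saA] AT SC by auto
  obtain d where d: "\<And>y. D y = d *\<^sub>C y"
    using selfadjoint_commutant_scalar[OF \<Omega> T1 D, OF _ saD] DT CS by auto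
  \<comment> \<open>This is the upper left entry of \<open>P\<close> applied twice.\<close>
  have 1: "a *\<^sub>C a *\<^sub>C x + B (C x) = a *\<^sub>C x" for x
    using idem[of "(x, 0)"] by (simp add: PE a d)
  have BC: "B (C x) = (a - a * a) *\<^sub>C x" for x
    using 1[of x] by (simp add: complex_vector.scale_left_diff_distrib scaleC_scaleC algebra_simps)
  obtain y0 where y0: "S y0 \<noteq> 0" using S_ne by auto
  have a01: "a - a * a = 0"
  proof (rule ccontr)
    \<comment> \<open>Otherwise \<open>B\<close> after \<open>C\<close> is a nonzero multiple of the
      identity, so \<open>C\<close> is injective, yet it kills \<open>S y0\<close>.\<close>
    assume ne: "a - a * a \<noteq> 0"
    have "C (S y0) \<noteq> 0"
      using BC[of "S y0"] ne y0 by auto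
    then show False using CS by simp
  qed
  \<comment> \<open>By \<open>adj\<close>, \<open>B\<close> is the adjoint of \<open>C\<close>, so
    the squared norm of \<open>C x\<close> is the product of \<open>x\<close> with
    \<open>B (C x) = 0\<close>.\<close>
  have C0: "C x = 0" for x
    using adj[of x "C x"] cinner_self_eq_0[of "C x"]
    by (simp add: BC a01 cinner_scaleC_right)
  have B0: "B y = 0" for y
    using adj[of "B y" y] cinner_self_eq_0[of "B y"] by (simp add: C0)
  \<comment> \<open>With \<open>B = 0\<close>, the upper right entry of the commutation relation
    says \<open>a *\<^sub>C S y0 = d *\<^sub>C S y0\<close>.\<close>
  have "(a - d) *\<^sub>C S y0 = 0"
    using BT[of y0] by (simp add: a d B0 bounded_clinear_apply[OF S]
        complex_vector.scale_left_diff_distrib)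
  then have "a = d" using y0 by auto
  then have Pa: "P p = a *\<^sub>C p" for p
    by (cases p) (simp add: PE a d B0 C0 scaleC_prod_def)
  have "a * (1 - a) = 0" using a01 by (simp add: algebra_simps)
  then consider "a = 0" | "a = 1" by auto
  then show "P = (\<lambda>x. 0) \<or> P = id"
    by cases (auto simp: fun_eq_iff Pa scaleC_one)
qed

section \<open>Idempotents commuting with the block operator with identity corner\<close>

lemma upper_block_id_strongly_irreducible:
  fixes T0 :: "'c::chilbert \<Rightarrow> 'c"
  assumes \<Omega>: "connected \<Omega>" and T0: "T0 \<in> cowen_douglas1 \<Omega>"
  shows "strongly_irreducible_op (upper_block T0 id T0)"
  unfolding strongly_irreducible_op_def
proof (intro allI impI, elim conjE)
  fix P assume P: "bounded_clinear P" and "P \<circ> P = P"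
    and comm: "P \<circ> upper_block T0 id T0 = upper_block T0 id T0 \<circ> P"
  then have idem: "\<And>p. P (P p) = P p" by (metis comp_apply)
  obtain A B C D where A: "bounded_clinear A" and B: "bounded_clinear B"
    and C: "bounded_clinear C" and D: "bounded_clinear D"
    and PE: "\<And>x y. P (x, y) = (A x + B y, C x + D y)"
    using bounded_clinear_blocks[OF P] by blast
  note zero = bounded_clinear_zero_apply
  note [simp] = zero[OF A] zero[OF B] zero[OF C] zero[OF D]
    zero[OF cowen_douglas1_clinear[OF T0]]
  have PT: "P (upper_block T0 id T0 p) = upper_block T0 id T0 (P p)" for p
    using comm by (metis comp_apply)
  have AT: "A (T0 x) = T0 (A x) + C x" and CT: "C (T0 x) = T0 (C x)" for x
    using PT[of "(x, 0)"] by (simp_all add: upper_block_def PE)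
  \<comment> \<open>Here the commutator of \<open>A\<close> with \<open>T0\<close> is
    \<open>C\<close> itself, so no adjoint relation is called for.\<close>
  have C0: "C x = 0" for x
    by (rule commutator_in_commutant_eq_0[OF T0 A C, OF AT CT])
  have BT: "A y + B (T0 y) = T0 (B y) + D y" and DT: "D (T0 y) = T0 (D y)" for y
    using PT[of "(0, y)"] by (simp_all add: upper_block_def PE C0)
  \<comment> \<open>With \<open>C = 0\<close> both \<open>A\<close> and \<open>D\<close> commute
    with \<open>T0\<close>, and \<open>BT\<close> exhibits \<open>D - A\<close> as the commutator of
    \<open>B\<close> with \<open>T0\<close>.\<close>
  have "D x - A x = 0" for x
  proof (rule commutator_in_commutant_eq_0[OF T0 B bounded_clinear_diff[OF D A]])
    show "B (T0 x) = T0 (B x) + (D x - A x)" for x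
      using BT[of x] by (simp add: algebra_simps)
    show "D (T0 x) - A (T0 x) = T0 (D x - A x)" for x
      by (simp add: AT DT C0 bounded_clinear_diff_apply[OF cowen_douglas1_clinear[OF T0]])
  qed
  then have DA: "D x = A x" for x by simp
  have AA: "A (A x) = A x" for x
    using idem[of "(x, 0)"] by (simp add: PE C0)
  obtain a where a: "\<And>x. A x = a *\<^sub>C x"
    using idempotent_commutant_scalar[OF \<Omega> T0 A, OF _ AA] AT C0 by auto
  show "P = (\<lambda>x. 0) \<or> P = id"
  proof (cases "\<exists>x::'c. x \<noteq> 0")
    \<comment> \<open>On the zero space, which occurs when \<Omega> is empty, \<open>a\<close> is
      not determined, but every map is zero.\<close>
    case False
    then have "p = 0" for p :: "'c \<times> 'c" by (simp add: prod_eq_iff)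
    then show ?thesis by (auto simp: fun_eq_iff)
  next
    case True
    then obtain x :: 'c where "x \<noteq> 0" by blast
    then have "a * a = a" using AA[of x] by (simp add: a scaleC_scaleC)
    then have a01: "a = 0 \<or> a = 1" by simp
    \<comment> \<open>This is the upper right entry of \<open>P\<close> applied twice; for
      \<open>a\<close> equal to 0 or 1 it forces \<open>B = 0\<close>.\<close>
    have "a *\<^sub>C B y + a *\<^sub>C B y = B y" for y
      using idem[of "(0, y)"]
      by (simp add: PE C0 DA a bounded_clinear_apply[OF B])
    then have B0: "B y = 0" for y
      using a01 by (metis add_cancel_left_right add_0 complex_vector.scale_zero_left scaleC_one)
    show ?thesis using a01
      by (auto simp: fun_eq_iff PE C0 B0 DA a scaleC_one zero_prod_def)
  qed
qed

theorem proposition2p20: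
  fixes \<Omega> :: "complex set"
  assumes "open \<Omega>" and "connected \<Omega>"
  shows "(\<forall>T \<in> (FB2 \<Omega> :: ('a::chilbert \<times> 'b::chilbert \<Rightarrow> 'a \<times> 'b) set). irreducible_op T) \<and>
    (\<forall>T0 \<in> (cowen_douglas1 \<Omega> :: ('c::chilbert \<Rightarrow> 'c) set).
      strongly_irreducible_op (upper_block T0 id T0))"
  using FB2_irreducible upper_block_id_strongly_irreducible assms(2) by blast

end
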